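(* Let $\varepsilon\in\mathbb{R}\cup\{\infty\}$ and let $I^-,I^+\subseteq I^2$ be the (disjoint) sets of indices fixed to $-1$ and to $1$, respectively, at a node of the branch-and-bound tree. Let $I^2_F=I^-\cup I^+$ and $I^2_R=I^2\setminus I^2_F$ be the fixed and non-fixed indices, and let $\sigma^F\in\{-1,1\}^{|I^2_F|}$ be the vector of all fixings, i.e. $\sigma^F_{ij}=-1$ for $ij\in I^-$ and $\sigma^F_{ij}=1$ for $ij\in I^+$. Then $\mathrm{SDP}(\varepsilon,I^-,I^+)$ is equivalent to the problem $\mathrm{SDP}^R(\varepsilon,I^-,I^+)$ given by $$\begin{aligned}\min\quad & K_1^R+\langle C_1^R,X^R\rangle+\langle c_1^R,x^R\rangle\\ \text{s.t.}\quad & K_2^R+\langle C_2^R,X^R\rangle+\langle c_2^R,x^R\rangle\le\varepsilon\\ & \sum_{k\in I,\ i\ne k\ne j}\big(\widetilde X_{ij,jk}-\widetilde X_{ij,ik}-\widetilde X_{ik,jk}\big)=-(n-2)\quad\forall i,j\in I,\ i<j\\ & \mathrm{diag}(X^R)=e\\ & \begin{pmatrix}1 & (x^R)^T \\ x^R & X^R\end{pmatrix}\succeq0,\end{aligned}$$ where $x^R\in\mathbb{R}^{|I^2_R|}$, $X^R\in\mathbb{R}^{|I^2_R|\times|I^2_R|}$, $$\widetilde X_{ij,kh}=\begin{cases}X^R_{ij,kh}&\text{if } ij,kh\in I^2_R\\ \sigma^F_{ij}x^R_{kh}&\text{if } ij\in I^2_F,\ kh\in I^2_R\\ \sigma^F_{kh}x^R_{ij}&\text{if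 } kh\in I^2_F,\ ij\in I^2_R\\ \sigma^F_{ij}\sigma^F_{kh}&\text{if } ij,kh\in I^2_F\end{cases}$$ for all $ij,kh\in I^2$ (extended to all $i\ne j$, $k\ne h$ by the index convention of the context), and, for $q\in\{1,2\}$, $$K_q^R=K_q+\langle (C_q)_{I^2_F,I^2_F},\sigma^F(\sigma^F)^T\rangle,\qquad C_q^R=(C_q)_{I^2_R,I^2_R},\qquad c_q^R=2\big((C_q)_{I^2_F,I^2_R}\big)^T\sigma^F.$$
   Context: **Data.** Let $I=\{1,\dots,n\}$ be a set of facilities with lengths $\ell_i\in\mathbb{R}_{>0}$, $i \in I$, and for $q\in\{1,2\}$ let $c^q_{ij}\in\mathbb{R}_{\ge 0}$, $i,j\in I$, be symmetric weights. Let $I^2=\{ij : i,j\in I,\ i<j\}$ (pairs written as two-letter indices), so $|I^2|=\binom n2$. For $q\in\{1,2\}$ let $K_q=\big(\sum_{i<j}\tfrac{c^q_{ij}}{2}\big)\big(\sum_{k\in I}\ell_k\big)$ and let $C_q=\tfrac12(\widetilde C_q+\widetilde C_q^T)\in\mathbb{R}^{\binom n2\times\binom n2}$, where for $ij,kh\in I^2$ the entry $(\widetilde C_q)_{ij,kh}$ equals $-\tfrac{c^q_{jh}}{2}\ell_i$ if $i<j<h$ and $k=i$; equals $\tfrac{c^q_{ih}}{2}\ell_j$ if $i<j<h$ and $k=j$; equals $-\tfrac{c^q_{ik}}{2}\ell_j$ if $i<k<j$ and $h=j$; and equals $0$ otherwise. $\langle\cdot,\cdot\rangle$ is the Frobenius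 (resp. Euclidean) inner product, $e$ is an all-ones vector of suitable size, and $(C_q)_{A,B}$ denotes the submatrix of $C_q$ with rows $A$ and columns $B$. **Variables and index convention.** $x\in\mathbb{R}^{\binom n2}$ and $X\in\mathbb{R}^{\binom n2\times\binom n2}$ (symmetric) are indexed by $I^2$; $x^R$ and $X^R$ (symmetric) are indexed by $I^2_R$. For $i\ne j$, $k\neq h$ not necessarily ordered, set $X_{ij,kh}=\tau(i,j)\tau(k,h)X_{\min\{i,j\}\max\{i,j\},\min\{k,h\}\max\{k,h\}}$, where $\tau(i,j)=1$ if $i<j$ and $\tau(i,j)=-1$ otherwise; the same convention is used for $\widetilde X$. **The problem $\mathrm{SDP}(\varepsilon,I^-,I^+)$.** Minimize $K_1+\langle C_1,X\rangle$ over $(x,X)$ subject to $K_2+\langle C_2,X\rangle\le\varepsilon$ (void if $\varepsilon=\infty$); $\sum_{k\in I,\, i\ne k\ne j}(X_{ij,jk}-X_{ij,ik}-X_{ik,jk})=-(n-2)$ for all $i,j\in I$, $i<j$; $\mathrm{diag}(X)=e$; $\begin{pmatrix}1 & x^T \\ x & X\end{pmatrix}\succeq0$; $x_{ij}=-1$ for all $ij\in I^-$; and $x_{ij}=1$ for all $ij\in I^+$. **Meaning of "equivalent".** The map sending $(x^R,X^R)$ to $(x,X)$ with $x_{ij}=x^R_{ij}$ for $ij\in I^2_R$, $x_{ij}=\sigma^F_{ij}$ for $ij\in I^2_F$, and $X=\widetilde X$, is a bijection from the feasible region of $\mathrm{SDP}^R(\varepsilon,I^-,I^+)$ onto the feasible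 region of $\mathrm{SDP}(\varepsilon,I^-,I^+)$ and it preserves objective function values. *)

theory Defs
  imports Complex_Main "HOL-Library.Extended_Real" "HOL-Library.FuncSet"
begin

text \<open>
  The facilities are \<open>{1..n}\<close> and the pair \<open>ij\<close> with \<open>i < j\<close> is \<open>(i, j)\<close>.
  A vector indexed by a finite set \<open>S\<close> of pairs is a function in \<^term>\<open>extensional S\<close>,
  a matrix with rows \<open>A\<close> and columns \<open>B\<close> is a function in \<^term>\<open>extensional (A \<times> B)\<close>;
  extensionality makes such functions correspond one-to-one to families of entries.
\<close>

type_synonym pair = "nat \<times> nat"
type_synonym pvec = "pair \<Rightarrow> real"
type_synonym pmat = "pair \<times> pair \<Rightarrow> real"

definition pairs :: "nat \<Rightarrow> pair set" where
  "pairs n = {(i, j). i \<in> {1..n} \<and> j \<in> {1..n} \<and> i < j}"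


text \<open>Euclidean inner product of vectors; Frobenius for \<open>S = A \<times> B\<close>.\<close>

definition inner_on :: "'a set \<Rightarrow> ('a \<Rightarrow> real) \<Rightarrow> ('a \<Rightarrow> real) \<Rightarrow> real" where
  "inner_on S a b = (\<Sum>p\<in>S. a p * b p)"

definition submatrix_on :: "('a \<times> 'b \<Rightarrow> real) \<Rightarrow> 'a set \<Rightarrow> 'b set \<Rightarrow> ('a \<times> 'b \<Rightarrow> real)" where
  "submatrix_on M A B = restrict M (A \<times> B)"

definition symmetric_on :: "'a set \<Rightarrow> ('a \<times> 'a \<Rightarrow> real) \<Rightarrow> bool" where
  "symmetric_on S M \<longleftrightarrow> (\<forall>p\<in>S. \<forall>q\<in>S. M (p, q) = M (q, p))"

definition psd_on :: "'a set \<Rightarrow> ('a \<times> 'a \<Rightarrow> real) \<Rightarrow> bool" where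
  "psd_on S M \<longleftrightarrow> symmetric_on S M \<and>
     (\<forall>v :: 'a \<Rightarrow> real. 0 \<le> (\<Sum>p\<in>S. \<Sum>q\<in>S. v p * M (p, q) * v q))"

text \<open>The matrix with first row \<open>(1, x\<^sup>T)\<close>, first column \<open>(1, x)\<close> and remaining
  block \<open>X\<close>; \<^const>\<open>None\<close> is the index of the additional row and column.\<close>

fun bordered :: "('a \<Rightarrow> real) \<Rightarrow> ('a \<times> 'a \<Rightarrow> real) \<Rightarrow> ('a option \<times> 'a option \<Rightarrow> real)" where
  "bordered x X (None, None) = 1"
| "bordered x X (None, Some q) = x q"
| "bordered x X (Some p, None) = x p"
| "bordered x X (Some p, Some q) = X (p, q)"

definition bordered_psd :: "'a set \<Rightarrow> ('a \<Rightarrow> real) \<Rightarrow> ('a \<times> 'a \<Rightarrow> real) \<Rightarrow> bool" where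
  "bordered_psd S x X \<longleftrightarrow> psd_on (insert None (Some ` S)) (bordered x X)"


definition K_const :: "nat \<Rightarrow> (nat \<Rightarrow> real) \<Rightarrow> (nat \<Rightarrow> nat \<Rightarrow> real) \<Rightarrow> real" where
  "K_const n l w = (\<Sum>(i, j)\<in>pairs n. w i j / 2) * (\<Sum>k\<in>{1..n}. l k)"

text \<open>The three nonzero cases are mutually exclusive, so their order is irrelevant.\<close>

definition C_tilde :: "nat \<Rightarrow> (nat \<Rightarrow> real) \<Rightarrow> (nat \<Rightarrow> nat \<Rightarrow> real) \<Rightarrow> pmat" where
  "C_tilde n l w = (\<lambda>((i, j), (k, h))\<in>pairs n \<times> pairs n.
     if i < j \<and> j < h \<and> k = i then - (w j h / 2) * l i
     else if i < j \<and> j < h \<and> k = j then (w i h / 2) * l j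
     else if i < k \<and> k < j \<and> h = j then - (w i k / 2) * l j
     else 0)"

definition C_mat :: "nat \<Rightarrow> (nat \<Rightarrow> real) \<Rightarrow> (nat \<Rightarrow> nat \<Rightarrow> real) \<Rightarrow> pmat" where
  "C_mat n l w = (\<lambda>(p, q)\<in>pairs n \<times> pairs n.
     (1 / 2) * (C_tilde n l w (p, q) + C_tilde n l w (q, p)))"


definition tau :: "nat \<Rightarrow> nat \<Rightarrow> real" where
  "tau i j = (if i < j then 1 else - 1)"

text \<open>The entry \<open>X\<^bsub>ij,kh\<^esub>\<close> for arbitrary \<open>i \<noteq> j\<close> and \<open>k \<noteq> h\<close>.\<close>

definition entry :: "pmat \<Rightarrow> nat \<Rightarrow> nat \<Rightarrow> nat \<Rightarrow> nat \<Rightarrow> real" where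
  "entry X i j k h = tau i j * tau k h * X ((min i j, max i j), (min k h, max k h))"

definition betweenness_eqs :: "nat \<Rightarrow> pmat \<Rightarrow> bool" where
  "betweenness_eqs n X \<longleftrightarrow> (\<forall>i\<in>{1..n}. \<forall>j\<in>{1..n}. i < j \<longrightarrow>
     (\<Sum>k\<in>{k\<in>{1..n}. i \<noteq> k \<and> k \<noteq> j}. entry X i j j k - entry X i j i k - entry X i k j k)
       = - (real n - 2))"


text \<open>The parameter \<open>c q i j\<close> stands for \<open>c\<^sup>q\<^sub>i\<^sub>j\<close>, \<open>q \<in> {1, 2}\<close>.\<close>

definition SDP_objective ::
  "nat \<Rightarrow> (nat \<Rightarrow> real) \<Rightarrow> (nat \<Rightarrow> nat \<Rightarrow> nat \<Rightarrow> real) \<Rightarrow> nat \<Rightarrow> pvec \<times> pmat \<Rightarrow> real" where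
  "SDP_objective n l c q = (\<lambda>(x, X).
     K_const n l (c q) + inner_on (pairs n \<times> pairs n) (C_mat n l (c q)) X)"

definition SDP_feasible ::
  "nat \<Rightarrow> (nat \<Rightarrow> real) \<Rightarrow> (nat \<Rightarrow> nat \<Rightarrow> nat \<Rightarrow> real) \<Rightarrow> ereal \<Rightarrow> pair set \<Rightarrow> pair set
     \<Rightarrow> (pvec \<times> pmat) set" where
  "SDP_feasible n l c eps Iminus Iplus = {(x, X).
     x \<in> extensional (pairs n) \<and> X \<in> extensional (pairs n \<times> pairs n) \<and>
     symmetric_on (pairs n) X \<and>
     ereal (SDP_objective n l c 2 (x, X)) \<le> eps \<and>
     betweenness_eqs n X \<and>
     (\<forall>p\<in>pairs n. X (p, p) = 1) \<and>
     bordered_psd (pairs n) x X \<and>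
     (\<forall>p\<in>Iminus. x p = - 1) \<and>
     (\<forall>p\<in>Iplus. x p = 1)}"


definition fixed_pairs :: "pair set \<Rightarrow> pair set \<Rightarrow> pair set" where
  "fixed_pairs Iminus Iplus = Iminus \<union> Iplus"

definition free_pairs :: "nat \<Rightarrow> pair set \<Rightarrow> pair set \<Rightarrow> pair set" where
  "free_pairs n Iminus Iplus = pairs n - fixed_pairs Iminus Iplus"

definition sigmaF :: "pair set \<Rightarrow> pair set \<Rightarrow> pvec" where
  "sigmaF Iminus Iplus = (\<lambda>p\<in>fixed_pairs Iminus Iplus. if p \<in> Iminus then - 1 else 1)"

definition KR_const ::
  "nat \<Rightarrow> (nat \<Rightarrow> real) \<Rightarrow> (nat \<Rightarrow> nat \<Rightarrow> real) \<Rightarrow> pair set \<Rightarrow> pair set \<Rightarrow> real" where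
  "KR_const n l w Iminus Iplus = (let F = fixed_pairs Iminus Iplus; s = sigmaF Iminus Iplus in
     K_const n l w
       + inner_on (F \<times> F) (submatrix_on (C_mat n l w) F F) (\<lambda>(p, q)\<in>F \<times> F. s p * s q))"

definition CR_mat ::
  "nat \<Rightarrow> (nat \<Rightarrow> real) \<Rightarrow> (nat \<Rightarrow> nat \<Rightarrow> real) \<Rightarrow> pair set \<Rightarrow> pair set \<Rightarrow> pmat" where
  "CR_mat n l w Iminus Iplus = (let R = free_pairs n Iminus Iplus in
     submatrix_on (C_mat n l w) R R)"

definition cR_vec ::
  "nat \<Rightarrow> (nat \<Rightarrow> real) \<Rightarrow> (nat \<Rightarrow> nat \<Rightarrow> real) \<Rightarrow> pair set \<Rightarrow> pair set \<Rightarrow> pvec" where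
  "cR_vec n l w Iminus Iplus = (let F = fixed_pairs Iminus Iplus;
       R = free_pairs n Iminus Iplus; s = sigmaF Iminus Iplus in
     (\<lambda>r\<in>R. 2 * (\<Sum>f\<in>F. submatrix_on (C_mat n l w) F R (f, r) * s f)))"

definition X_tilde :: "nat \<Rightarrow> pair set \<Rightarrow> pair set \<Rightarrow> pvec \<Rightarrow> pmat \<Rightarrow> pmat" where
  "X_tilde n Iminus Iplus xR XR = (let F = fixed_pairs Iminus Iplus;
       R = free_pairs n Iminus Iplus; s = sigmaF Iminus Iplus in
     (\<lambda>(p, q)\<in>pairs n \<times> pairs n.
        if p \<in> R \<and> q \<in> R then XR (p, q)
        else if p \<in> F \<and> q \<in> R then s p * xR q
        else if q \<in> F \<and> p \<in> R then s q * xR p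
        else s p * s q))"

definition SDPR_objective ::
  "nat \<Rightarrow> (nat \<Rightarrow> real) \<Rightarrow> (nat \<Rightarrow> nat \<Rightarrow> nat \<Rightarrow> real) \<Rightarrow> pair set \<Rightarrow> pair set \<Rightarrow> nat
     \<Rightarrow> pvec \<times> pmat \<Rightarrow> real" where
  "SDPR_objective n l c Iminus Iplus q = (\<lambda>(xR, XR). let R = free_pairs n Iminus Iplus in
     KR_const n l (c q) Iminus Iplus
       + inner_on (R \<times> R) (CR_mat n l (c q) Iminus Iplus) XR
       + inner_on R (cR_vec n l (c q) Iminus Iplus) xR)"

definition SDPR_feasible ::
  "nat \<Rightarrow> (nat \<Rightarrow> real) \<Rightarrow> (nat \<Rightarrow> nat \<Rightarrow> nat \<Rightarrow> real) \<Rightarrow> ereal \<Rightarrow> pair set \<Rightarrow> pair set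
     \<Rightarrow> (pvec \<times> pmat) set" where
  "SDPR_feasible n l c eps Iminus Iplus = {(xR, XR). let R = free_pairs n Iminus Iplus in
     xR \<in> extensional R \<and> XR \<in> extensional (R \<times> R) \<and>
     symmetric_on R XR \<and>
     ereal (SDPR_objective n l c Iminus Iplus 2 (xR, XR)) \<le> eps \<and>
     betweenness_eqs n (X_tilde n Iminus Iplus xR XR) \<and>
     (\<forall>p\<in>R. XR (p, p) = 1) \<and>
     bordered_psd R xR XR}"


definition lift_sol :: "nat \<Rightarrow> pair set \<Rightarrow> pair set \<Rightarrow> pvec \<times> pmat \<Rightarrow> pvec \<times> pmat" where
  "lift_sol n Iminus Iplus = (\<lambda>(xR, XR).
     ((\<lambda>p\<in>pairs n. if p \<in> free_pairs n Iminus Iplus then xR p else sigmaF Iminus Iplus p),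
      X_tilde n Iminus Iplus xR XR))"

definition equivalent_via ::
  "('a \<Rightarrow> 'b) \<Rightarrow> 'a set \<Rightarrow> ('a \<Rightarrow> real) \<Rightarrow> 'b set \<Rightarrow> ('b \<Rightarrow> real) \<Rightarrow> bool" where
  "equivalent_via \<phi> A f B g \<longleftrightarrow> bij_betw \<phi> A B \<and> (\<forall>a\<in>A. g (\<phi> a) = f a)"

end

theory Submission
  imports Defs
begin

text \<open>
  If a positive semidefinite matrix \<open>M\<close> has \<open>M\<^sub>a\<^sub>a = M\<^sub>b\<^sub>b = 1\<close> and \<open>M\<^sub>a\<^sub>b = s\<close> with
  \<open>s\<^sup>2 = 1\<close>, then \<open>e\<^sub>a - s e\<^sub>b\<close> is in its kernel, so column \<open>a\<close> is \<open>s\<close> times column \<open>b\<close>.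
  Applied to the bordered matrix, this shows that fixing \<open>x\<^sub>f\<close> to \<open>\<sigma>\<^sub>f\<close> forces \<open>X\<^sub>p\<^sub>f = \<sigma>\<^sub>f x\<^sub>p\<close> for
  every \<open>p\<close>, i.e. \<open>X = X\<^sup>~\<close>. Conversely the lifted bordered matrix arises from the reduced one by a
  congruence that repeats the border row and column with signs \<open>\<sigma>\<^sub>f\<close>, so it is positive
  semidefinite as well.
\<close>

section \<open>Positive semidefinite matrices and their bordered form\<close>

text \<open>\<open>N = A^T M A\<close>, where column \<open>a\<close> of \<open>A\<close> has the
  single entry \<open>t a\<close>, in row \<open>g a\<close>. Several indices may share an image
  under \<open>g\<close>, which is how all fixed pairs can be sent to the border;
  \<open>g = id\<close> with \<open>t = 1\<close> yields principal submatrices.\<close>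

lemma psd_on_congruence:
  fixes M :: "'a \<times> 'a \<Rightarrow> real" and N :: "'b \<times> 'b \<Rightarrow> real"
  assumes "finite S" "finite T" "g ` S \<subseteq> T" "psd_on T M"
    and N: "\<And>a b. a \<in> S \<Longrightarrow> b \<in> S \<Longrightarrow> N (a, b) = t a * t b * M (g a, g b)"
  shows "psd_on S N"
proof -
  have sym: "symmetric_on S N"
    using assms unfolding psd_on_def symmetric_on_def by (auto simp: image_subset_iff)
  have "0 \<le> (\<Sum>a\<in>S. \<Sum>b\<in>S. v a * N (a, b) * v b)" for v
  proof -
    \<comment> \<open>\<open>u\<close> is the vector \<open>A v\<close>: the weighted entries of
      \<open>v\<close> collected over each fibre of \<open>g\<close>. The fact \<open>group\<close>
      then serves once for columns and once for rows.\<close>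
    define u where "u = (\<lambda>p. \<Sum>a\<in>{a \<in> S. g a = p}. v a * t a)"
    have group: "(\<Sum>a\<in>S. v a * t a * h (g a)) = (\<Sum>p\<in>T. u p * h p)" for h :: "'a \<Rightarrow> real"
    proof -
      have "(\<Sum>a\<in>S. v a * t a * h (g a)) = (\<Sum>p\<in>T. \<Sum>a\<in>{a \<in> S. g a = p}. v a * t a * h (g a))"
        using sum.group[OF assms(1-3), of "\<lambda>a. v a * t a * h (g a)"] by simp
      also have "\<dots> = (\<Sum>p\<in>T. u p * h p)"
        by (auto simp: u_def sum_distrib_right intro!: sum.cong)
      finally show ?thesis .
    qed
    have "(\<Sum>a\<in>S. \<Sum>b\<in>S. v a * N (a, b) * v b)
        = (\<Sum>a\<in>S. v a * t a * (\<Sum>b\<in>S. v b * t b * M (g a, g b)))"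
      by (simp add: N sum_distrib_left mult_ac)
    also have "\<dots> = (\<Sum>a\<in>S. v a * t a * (\<Sum>q\<in>T. u q * M (g a, q)))"
    proof -
      have "(\<Sum>b\<in>S. v b * t b * M (g a, g b)) = (\<Sum>q\<in>T. u q * M (g a, q))" for a
        using group[of "\<lambda>q. M (g a, q)"] by simp
      then show ?thesis
        by simp
    qed
    also have "\<dots> = (\<Sum>p\<in>T. u p * (\<Sum>q\<in>T. u q * M (p, q)))"
      using group[of "\<lambda>p. \<Sum>q\<in>T. u q * M (p, q)"] by simp
    also have "\<dots> = (\<Sum>p\<in>T. \<Sum>q\<in>T. u p * M (p, q) * u q)"
      by (simp add: sum_distrib_left mult_ac)
    also have "\<dots> \<ge> 0"
      using assms(4) unfolding psd_on_def by blast
    finally show ?thesis .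
  qed
  with sym show ?thesis
    unfolding psd_on_def by blast
qed

lemma psd_on_unit_columns:
  fixes M :: "'a \<times> 'a \<Rightarrow> real"
  assumes "finite S" and psd: "psd_on S M" and mem: "a \<in> S" "b \<in> S" "p \<in> S"
    and diag: "M (a, a) = 1" "M (b, b) = 1" and s: "M (a, b) = s" "s * s = 1"
  shows "M (p, a) = s * M (p, b)"
proof -
  define d where "d = M (p, a) - s * M (p, b)"
  have sym: "M (a, p) = M (p, a)" "M (b, p) = M (p, b)" "M (b, a) = s"
    using psd mem s unfolding psd_on_def symmetric_on_def by auto
  have quad: "0 \<le> 2 * t * d + M (p, p)" for t
  proof -
    \<comment> \<open>The test vector is \<open>t (e_a - s e_b) + e_p\<close>. Its part along
      \<open>t\<close> has form value \<open>1 - s * s = 0\<close>, so the quadratic form is affine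
      in \<open>t\<close>. A sum of indicators also covers coincidences among \<open>a\<close>,
      \<open>b\<close> and \<open>p\<close>.\<close>
    define v where "v = (\<lambda>q. t * of_bool (q = a) - t * s * of_bool (q = b) + of_bool (q = p))"
    have pick: "(\<Sum>q\<in>S. v q * h q) = t * h a - t * s * h b + h p" for h
    proof -
      have delta: "(\<Sum>q\<in>S. of_bool (q = r) * h q) = h r" if "r \<in> S" for r
        using that \<open>finite S\<close> by (simp add: of_bool_def if_distrib[of "\<lambda>x. x * _"] cong: if_cong)
      have "(\<Sum>q\<in>S. v q * h q) = t * (\<Sum>q\<in>S. of_bool (q = a) * h q)
          - t * s * (\<Sum>q\<in>S. of_bool (q = b) * h q) + (\<Sum>q\<in>S. of_bool (q = p) * h q)"
        by (simp only: v_def sum_distrib_left sum_subtractf[symmetric] sum.distrib[symmetric])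
          (simp add: algebra_simps)
      then show ?thesis
        using mem by (simp only: delta)
    qed
    have "0 \<le> (\<Sum>q\<in>S. \<Sum>r\<in>S. v q * M (q, r) * v r)"
      using psd unfolding psd_on_def by blast
    also have "\<dots> = (\<Sum>q\<in>S. v q * (\<Sum>r\<in>S. v r * M (q, r)))"
      by (simp add: sum_distrib_left mult_ac)
    also have "\<dots> = 2 * t * d + M (p, p) + t * t * (1 - s * s)"
      by (simp add: pick d_def sym diag s(1)) (simp add: algebra_simps)
    finally show ?thesis
      using s by simp
  qed
  have "d = 0"
  proof (rule ccontr)
    assume "d \<noteq> 0"
    \<comment> \<open>An affine function with nonzero slope \<open>2 * d\<close> cannot stay
      nonnegative: this choice of \<open>t\<close> gives it the value -1.\<close>
    then show False
      using quad[of "- (M (p, p) + 1) / (2 * d)"] by (simp add: field_simps)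
  qed
  then show ?thesis
    by (simp add: d_def)
qed

text \<open>The border index \<open>None\<close> acts as the unit column \<open>b\<close>: its
  diagonal entry is 1 and its column lists the entries of \<open>x\<close>.\<close>

lemma bordered_psd_unit_entry:
  assumes "finite S" "bordered_psd S x X" "f \<in> S" "p \<in> S" "X (f, f) = 1" "x f * x f = 1"
  shows "X (p, f) = x f * x p"
  using psd_on_unit_columns[of "insert None (Some ` S)" "bordered x X" "Some f" None "Some p" "x f"]
    assms by (simp add: bordered_psd_def)

lemma bordered_psd_restrict:
  assumes "finite S" "T \<subseteq> S" "bordered_psd S x X"
  shows "bordered_psd T (restrict x T) (restrict X (T \<times> T))"
  unfolding bordered_psd_def
proof (rule psd_on_congruence[where T = "insert None (Some ` S)" and M = "bordered x X"
      and t = "\<lambda>_. 1" and g = id])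
  show "finite (insert None (Some ` T))"
    using assms finite_subset by auto
  fix a b assume "a \<in> insert None (Some ` T)" "b \<in> insert None (Some ` T)"
  then show "bordered (restrict x T) (restrict X (T \<times> T)) (a, b)
      = 1 * 1 * bordered x X (id a, id b)"
    by (cases a; cases b) auto
qed (use assms in \<open>auto simp: bordered_psd_def\<close>)

section \<open>Fixed pairs and the objective function\<close>

lemma finite_pairs: "finite (pairs n)"
  by (rule finite_subset[of _ "{1..n} \<times> {1..n}"]) (auto simp: pairs_def)

lemma sigmaF_square: "p \<in> fixed_pairs Iminus Iplus \<Longrightarrow> sigmaF Iminus Iplus p * sigmaF Iminus Iplus p = 1"
  by (simp add: sigmaF_def)

text \<open>The free pairs are the complement of the fixed ones in \<open>pairs n\<close>, so the
  four cases reduce to one membership test per index, a form suited to case splitting.\<close>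

lemma X_tilde_simps:
  assumes "p \<in> pairs n" "q \<in> pairs n"
  shows "X_tilde n Iminus Iplus xR XR (p, q) =
    (if p \<in> fixed_pairs Iminus Iplus
     then if q \<in> fixed_pairs Iminus Iplus then sigmaF Iminus Iplus p * sigmaF Iminus Iplus q else sigmaF Iminus Iplus p * xR q
     else if q \<in> fixed_pairs Iminus Iplus then sigmaF Iminus Iplus q * xR p else XR (p, q))"
  using assms by (simp add: X_tilde_def free_pairs_def Let_def)

lemma C_mat_sym: "p \<in> pairs n \<Longrightarrow> q \<in> pairs n \<Longrightarrow> C_mat n l w (q, p) = C_mat n l w (p, q)"
  by (simp add: C_mat_def)

text \<open>Splitting the inner product into blocks by fixed (\<open>F\<close>) and free
  (\<open>R\<close>) indices, the \<open>F F\<close> block joins the constant, the two mixed blocks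
  form the linear term, and the \<open>R R\<close> block is the reduced quadratic term. The case
  \<open>q = 1\<close> concerns the objective, \<open>q = 2\<close> the bound by
  \<open>eps\<close>.\<close>

lemma SDP_objective_lift_sol:
  assumes "Iminus \<subseteq> pairs n" "Iplus \<subseteq> pairs n"
  shows "SDP_objective n l c q (lift_sol n Iminus Iplus z) = SDPR_objective n l c Iminus Iplus q z"
proof (cases z)
  case (Pair xR XR)
  define F R s C Xt where defs: "F = fixed_pairs Iminus Iplus" "R = free_pairs n Iminus Iplus"
    "s = sigmaF Iminus Iplus" "C = C_mat n l (c q)" "Xt = X_tilde n Iminus Iplus xR XR"
  have F: "F \<subseteq> pairs n" and R: "R = pairs n - F"
    using assms by (auto simp: defs fixed_pairs_def free_pairs_def)
  have fin: "finite F" "finite R" and P: "pairs n = F \<union> R" "F \<inter> R = {}"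
    using F R finite_pairs[of n] finite_subset by auto
  have Xt:
    "\<And>p q. p \<in> F \<Longrightarrow> q \<in> F \<Longrightarrow> Xt (p, q) = s p * s q"
    "\<And>p q. p \<in> F \<Longrightarrow> q \<in> R \<Longrightarrow> Xt (p, q) = s p * xR q"
    "\<And>p q. p \<in> R \<Longrightarrow> q \<in> F \<Longrightarrow> Xt (p, q) = s q * xR p"
    "\<And>p q. p \<in> R \<Longrightarrow> q \<in> R \<Longrightarrow> Xt (p, q) = XR (p, q)"
    using P by (auto simp: X_tilde_simps defs(1,3,5))
  let ?B = "\<lambda>A B. \<Sum>p\<in>A. \<Sum>q\<in>B. C (p, q) * Xt (p, q)"
  have "inner_on (pairs n \<times> pairs n) C Xt = ?B (pairs n) (pairs n)"
    by (simp add: inner_on_def sum.cartesian_product)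
  also have "\<dots> = ?B F F + ?B F R + (?B R F + ?B R R)"
    using fin P(2) by (simp add: P(1) sum.union_disjoint sum.distrib)
  \<comment> \<open>The matrix \<open>C\<close> and the mixed entries of \<open>Xt\<close> are
    symmetric; the two equal blocks produce the factor 2 in \<open>cR_vec\<close>.\<close>
  also have "?B F R = ?B R F"
    by (subst sum.swap, intro sum.cong refl) (use P in \<open>auto simp: Xt defs(4) C_mat_sym\<close>)
  finally have split: "inner_on (pairs n \<times> pairs n) C Xt = ?B F F + 2 * ?B R F + ?B R R"
    by simp
  have FF: "inner_on (F \<times> F) (submatrix_on C F F) (\<lambda>(p, q)\<in>F \<times> F. s p * s q) = ?B F F"
    by (simp add: inner_on_def sum.cartesian_product submatrix_on_def)
      (auto intro!: sum.cong simp: Xt)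
  have RR: "inner_on (R \<times> R) (CR_mat n l (c q) Iminus Iplus) XR = ?B R R"
    unfolding inner_on_def sum.cartesian_product CR_mat_def Let_def submatrix_on_def defs(2)[symmetric]
      defs(4)[symmetric]
    by (auto intro!: sum.cong simp: Xt)
  have "inner_on R (cR_vec n l (c q) Iminus Iplus) xR = (\<Sum>r\<in>R. 2 * (\<Sum>f\<in>F. C (f, r) * s f) * xR r)"
    unfolding inner_on_def cR_vec_def Let_def submatrix_on_def defs(1-4)[symmetric]
    by (intro sum.cong) auto
  also have "\<dots> = 2 * (\<Sum>r\<in>R. \<Sum>f\<in>F. C (f, r) * (s f * xR r))"
    by (simp add: sum_distrib_left sum_distrib_right mult_ac)
  also have "(\<Sum>r\<in>R. \<Sum>f\<in>F. C (f, r) * (s f * xR r)) = ?B R F"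
    by (intro sum.cong refl) (use P in \<open>auto simp: Xt defs(4) C_mat_sym\<close>)
  finally have RF: "inner_on R (cR_vec n l (c q) Iminus Iplus) xR = 2 * ?B R F" .
  have "SDP_objective n l c q (lift_sol n Iminus Iplus z)
      = K_const n l (c q) + inner_on (pairs n \<times> pairs n) C Xt"
    by (simp add: SDP_objective_def lift_sol_def Pair defs)
  moreover have "SDPR_objective n l c Iminus Iplus q z
      = K_const n l (c q) + ?B F F + ?B R R + 2 * ?B R F"
    unfolding SDPR_objective_def KR_const_def Let_def Pair prod.case
      defs(1-4)[symmetric] FF RR RF by simp
  ultimately show ?thesis
    using split by simp
qed

section \<open>Feasibility under lifting\<close>

lemma bordered_psd_lift_sol:
  assumes "bordered_psd (free_pairs n Iminus Iplus) xR XR" and "lift_sol n Iminus Iplus (xR, XR) = (x, X)"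
  shows "bordered_psd (pairs n) x X"
  unfolding bordered_psd_def
\<comment> \<open>Fixed pairs map to the border \<open>None\<close> with their sign as weight, free
  pairs to themselves with weight 1. As the corner entry is 1, a fixed \<open>f\<close> gets the
  entry \<open>sigmaF f\<close> in the border, sign products against fixed pairs, and
  \<open>sigmaF f * xR r\<close> against a free \<open>r\<close>.\<close>
proof (rule psd_on_congruence[where T = "insert None (Some ` free_pairs n Iminus Iplus)"
      and M = "bordered xR XR"
      and t = "\<lambda>a. case a of None \<Rightarrow> 1 | Some p \<Rightarrow> if p \<in> fixed_pairs Iminus Iplus then sigmaF Iminus Iplus p else 1"
      and g = "\<lambda>a. case a of None \<Rightarrow> None | Some p \<Rightarrow> if p \<in> fixed_pairs Iminus Iplus then None else Some p"])
  show "finite (insert None (Some ` pairs n))" "finite (insert None (Some ` free_pairs n Iminus Iplus))"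
    using finite_pairs by (auto simp: free_pairs_def)
  show "psd_on (insert None (Some ` free_pairs n Iminus Iplus)) (bordered xR XR)"
    using assms(1) by (simp add: bordered_psd_def)
  have x: "x = (\<lambda>p\<in>pairs n. if p \<in> free_pairs n Iminus Iplus then xR p else sigmaF Iminus Iplus p)"
    and X: "X = X_tilde n Iminus Iplus xR XR"
    using assms(2) by (auto simp: lift_sol_def)
  fix a b assume "a \<in> insert None (Some ` pairs n)" "b \<in> insert None (Some ` pairs n)"
  then show "bordered x X (a, b) =
      (case a of None \<Rightarrow> 1 | Some p \<Rightarrow> if p \<in> fixed_pairs Iminus Iplus then sigmaF Iminus Iplus p else 1) *
      (case b of None \<Rightarrow> 1 | Some p \<Rightarrow> if p \<in> fixed_pairs Iminus Iplus then sigmaF Iminus Iplus p else 1) *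
      bordered xR XR
        (case a of None \<Rightarrow> None | Some p \<Rightarrow> if p \<in> fixed_pairs Iminus Iplus then None else Some p,
         case b of None \<Rightarrow> None | Some p \<Rightarrow> if p \<in> fixed_pairs Iminus Iplus then None else Some p)"
    by (cases a; cases b) (auto simp: x X X_tilde_simps free_pairs_def)
qed (auto simp: free_pairs_def split: if_splits)

lemma lift_sol_feasible:
  assumes "Iminus \<subseteq> pairs n" "Iplus \<subseteq> pairs n" "Iminus \<inter> Iplus = {}"
    and feas: "z \<in> SDPR_feasible n l c eps Iminus Iplus"
  shows "lift_sol n Iminus Iplus z \<in> SDP_feasible n l c eps Iminus Iplus"
proof -
  obtain xR XR where z: "z = (xR, XR)"
    by (cases z)
  define x X where xX:
    "x = (\<lambda>p\<in>pairs n. if p \<in> free_pairs n Iminus Iplus then xR p else sigmaF Iminus Iplus p)"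
    "X = X_tilde n Iminus Iplus xR XR"
  have lift: "lift_sol n Iminus Iplus (xR, XR) = (x, X)"
    by (simp add: lift_sol_def xX)
  have "symmetric_on (free_pairs n Iminus Iplus) XR" and diag: "\<forall>p\<in>free_pairs n Iminus Iplus. XR (p, p) = 1"
    and obj: "ereal (SDPR_objective n l c Iminus Iplus 2 (xR, XR)) \<le> eps"
    and btw: "betweenness_eqs n X" and psd: "bordered_psd (free_pairs n Iminus Iplus) xR XR"
    using feas by (auto simp: z SDPR_feasible_def Let_def xX)
  then have "symmetric_on (pairs n) X"
    by (auto simp: symmetric_on_def xX X_tilde_simps free_pairs_def)
  moreover have "\<forall>p\<in>pairs n. X (p, p) = 1"
    using diag by (auto simp: xX X_tilde_simps free_pairs_def sigmaF_square)
  moreover have "ereal (SDP_objective n l c 2 (x, X)) \<le> eps"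
    using obj SDP_objective_lift_sol[OF assms(1,2), of l c 2 "(xR, XR)"] by (simp add: lift)
  moreover have "bordered_psd (pairs n) x X"
    using bordered_psd_lift_sol[OF psd lift] .
  \<comment> \<open>\<open>sigmaF\<close> tests membership in \<open>Iminus\<close> first, so its
    value 1 on \<open>Iplus\<close> rests on disjointness.\<close>
  moreover have "\<forall>p\<in>Iminus. x p = - 1" "\<forall>p\<in>Iplus. x p = 1"
    using assms(1-3) by (auto simp: xX free_pairs_def fixed_pairs_def sigmaF_def)
  ultimately show ?thesis
    using btw by (simp add: z lift SDP_feasible_def) (simp add: xX X_tilde_def Let_def)
qed

section \<open>Restriction to the free pairs as the inverse of lifting\<close>

text \<open>Surjectivity of the lift: semidefiniteness forces all rows and columns of
  \<open>X\<close> at fixed pairs, so the free block determines the whole solution.\<close>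

lemma lift_sol_restrict:
  assumes sub: "Iminus \<subseteq> pairs n" "Iplus \<subseteq> pairs n" and disj: "Iminus \<inter> Iplus = {}"
    and feas: "(x, X) \<in> SDP_feasible n l c eps Iminus Iplus"
    and R: "R = free_pairs n Iminus Iplus"
  shows "lift_sol n Iminus Iplus (restrict x R, restrict X (R \<times> R)) = (x, X)"
proof -
  have ext: "x \<in> extensional (pairs n)" "X \<in> extensional (pairs n \<times> pairs n)"
    and sym: "symmetric_on (pairs n) X" and diag: "\<forall>p\<in>pairs n. X (p, p) = 1"
    and psd: "bordered_psd (pairs n) x X"
    and x_fixed: "\<forall>p\<in>Iminus. x p = - 1" "\<forall>p\<in>Iplus. x p = 1"
    using feas by (auto simp: SDP_feasible_def)
  have x: "x p = sigmaF Iminus Iplus p" if "p \<in> fixed_pairs Iminus Iplus" for p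
    using that x_fixed disj by (auto simp: sigmaF_def fixed_pairs_def)
  have F: "p \<in> pairs n" if "p \<in> fixed_pairs Iminus Iplus" for p
    using that sub by (auto simp: fixed_pairs_def)
  have col: "X (p, f) = sigmaF Iminus Iplus f * x p" if "f \<in> fixed_pairs Iminus Iplus" "p \<in> pairs n" for p f
    using bordered_psd_unit_entry[OF finite_pairs psd, of f p] that diag F x sigmaF_square by auto
  have row: "X (f, p) = sigmaF Iminus Iplus f * x p" if "f \<in> fixed_pairs Iminus Iplus" "p \<in> pairs n" for p f
    using col[OF that] sym that F by (simp add: symmetric_on_def)
  have "(\<lambda>p\<in>pairs n. if p \<in> R then restrict x R p else sigmaF Iminus Iplus p) = x"
    by (rule extensionalityI[OF _ ext(1)]) (auto simp: R free_pairs_def x)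
  moreover have "X_tilde n Iminus Iplus (restrict x R) (restrict X (R \<times> R)) = X"
  proof (rule extensionalityI[OF _ ext(2)])
    show "X_tilde n Iminus Iplus (restrict x R) (restrict X (R \<times> R)) \<in> extensional (pairs n \<times> pairs n)"
      by (simp add: X_tilde_def Let_def)
    fix pq assume "pq \<in> pairs n \<times> pairs n"
    then show "X_tilde n Iminus Iplus (restrict x R) (restrict X (R \<times> R)) pq = X pq"
      by (cases pq) (auto simp: X_tilde_simps R free_pairs_def row col x)
  qed
  ultimately show ?thesis
    by (simp add: lift_sol_def R[symmetric])
qed

text \<open>Since lifting the restriction returns \<open>(x, X)\<close>, the betweenness equations
  and the bound by \<open>eps\<close> transfer as equalities; semidefiniteness passes to the
  principal submatrix.\<close>

lemma restrict_feasible: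
  assumes sub: "Iminus \<subseteq> pairs n" "Iplus \<subseteq> pairs n" and "Iminus \<inter> Iplus = {}"
    and feas: "(x, X) \<in> SDP_feasible n l c eps Iminus Iplus"
    and R: "R = free_pairs n Iminus Iplus"
  shows "(restrict x R, restrict X (R \<times> R)) \<in> SDPR_feasible n l c eps Iminus Iplus"
proof -
  have lift: "lift_sol n Iminus Iplus (restrict x R, restrict X (R \<times> R)) = (x, X)"
    by (rule lift_sol_restrict[OF assms])
  then have Xt: "X_tilde n Iminus Iplus (restrict x R) (restrict X (R \<times> R)) = X"
    by (simp add: lift_sol_def)
  have sub_R: "R \<subseteq> pairs n"
    by (auto simp: R free_pairs_def)
  have "symmetric_on (pairs n) X" and diag: "\<forall>p\<in>R. X (p, p) = 1"
    and obj: "ereal (SDP_objective n l c 2 (x, X)) \<le> eps" and btw: "betweenness_eqs n X"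
    and psd: "bordered_psd (pairs n) x X"
    using feas sub_R by (auto simp: SDP_feasible_def)
  then have sym: "symmetric_on R (restrict X (R \<times> R))"
    using sub_R by (auto simp: symmetric_on_def)
  have "ereal (SDPR_objective n l c Iminus Iplus 2 (restrict x R, restrict X (R \<times> R))) \<le> eps"
    using obj SDP_objective_lift_sol[OF sub, of l c 2 "(restrict x R, restrict X (R \<times> R))"]
    by (simp add: lift)
  then show ?thesis
    using sym diag btw bordered_psd_restrict[OF finite_pairs sub_R psd]
    by (simp add: SDPR_feasible_def Let_def R[symmetric] Xt)
qed

text \<open>Injectivity of the lift: it copies the free entries, and extensionality settles all
  other arguments.\<close>

lemma restrict_lift_sol:
  assumes "(xR, XR) \<in> SDPR_feasible n l c eps Iminus Iplus"
    and "lift_sol n Iminus Iplus (xR, XR) = (x, X)"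
    and R: "R = free_pairs n Iminus Iplus"
  shows "(restrict x R, restrict X (R \<times> R)) = (xR, XR)"
proof -
  have ext: "xR \<in> extensional R" "XR \<in> extensional (R \<times> R)"
    using assms(1) by (auto simp: SDPR_feasible_def Let_def R)
  have x: "x = (\<lambda>p\<in>pairs n. if p \<in> free_pairs n Iminus Iplus then xR p else sigmaF Iminus Iplus p)"
    and X: "X = X_tilde n Iminus Iplus xR XR"
    using assms(2) by (auto simp: lift_sol_def)
  have "restrict x R = xR"
    by (rule extensionalityI[OF _ ext(1)]) (auto simp: x R free_pairs_def)
  moreover have "restrict X (R \<times> R) = XR"
    by (rule extensionalityI[OF _ ext(2)]) (auto simp: X R free_pairs_def X_tilde_simps)
  ultimately show ?thesis
    by simp
qed

theorem proposition5:
  fixes n :: nat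
    and l :: "nat \<Rightarrow> real"
    and c :: "nat \<Rightarrow> nat \<Rightarrow> nat \<Rightarrow> real"
    and eps :: ereal
    and Iminus Iplus :: "(nat \<times> nat) set"
  assumes "\<forall>i\<in>{1..n}. l i > 0"
    and "\<forall>q\<in>{1, 2}. \<forall>i\<in>{1..n}. \<forall>j\<in>{1..n}. c q i j \<ge> 0"
    and "\<forall>q\<in>{1, 2}. \<forall>i\<in>{1..n}. \<forall>j\<in>{1..n}. c q i j = c q j i"
    and "eps \<noteq> - \<infinity>"
    and "Iminus \<subseteq> pairs n"
    and "Iplus \<subseteq> pairs n"
    and "Iminus \<inter> Iplus = {}"
  shows "equivalent_via (lift_sol n Iminus Iplus)
           (SDPR_feasible n l c eps Iminus Iplus) (SDPR_objective n l c Iminus Iplus 1)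
           (SDP_feasible n l c eps Iminus Iplus) (SDP_objective n l c 1)"
proof -
  note sub = assms(5-7)
  define R where "R = free_pairs n Iminus Iplus"
  have "bij_betw (lift_sol n Iminus Iplus)
      (SDPR_feasible n l c eps Iminus Iplus) (SDP_feasible n l c eps Iminus Iplus)"
  proof (rule bij_betwI[where g = "\<lambda>(x, X). (restrict x R, restrict X (R \<times> R))"])
    show "lift_sol n Iminus Iplus
        \<in> SDPR_feasible n l c eps Iminus Iplus \<rightarrow> SDP_feasible n l c eps Iminus Iplus"
      using lift_sol_feasible[OF sub] by blast
    show "(\<lambda>(x, X). (restrict x R, restrict X (R \<times> R)))
        \<in> SDP_feasible n l c eps Iminus Iplus \<rightarrow> SDPR_feasible n l c eps Iminus Iplus"
      using restrict_feasible[OF sub _ R_def] by auto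
    fix z assume "z \<in> SDPR_feasible n l c eps Iminus Iplus"
    then show "(case lift_sol n Iminus Iplus z of (x, X) \<Rightarrow> (restrict x R, restrict X (R \<times> R))) = z"
      using restrict_lift_sol[OF _ _ R_def] by (cases z) (auto split: prod.split)
  next
    fix z assume "z \<in> SDP_feasible n l c eps Iminus Iplus"
    then show "lift_sol n Iminus Iplus
        (case z of (x, X) \<Rightarrow> (restrict x R, restrict X (R \<times> R))) = z"
      using lift_sol_restrict[OF sub _ R_def] by (cases z) auto
  qed
  then show ?thesis
    by (simp add: equivalent_via_def SDP_objective_lift_sol[OF sub(1,2)])
qed

end
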